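(* Let $w$ be a weight vector. If a monomial ideal $I\subset S=\mathbb{K}[x_1,\dots,x_n]$ is $w$-stable, then $I$ is strongly stable.
   Context: Let $\mathbb{K}$ be a field, $S=\mathbb{K}[x_1,\dots,x_n]$, $R=\mathbb{K}[y_1,\dots,y_n]$, with variable orders $x_1>\dots>x_n$ and $y_1>\dots>y_n$. A weight vector is $w=(w_1,\dots,w_n)$ of positive integers with $w_1\ge w_2\ge\dots\ge w_n$. Let $\psi:S\to R$ be the $\mathbb{K}$-algebra homomorphism with $\psi(x_i)=y_i^{w_i}$. A Borel move on a monomial $m$ in a polynomial ring with variables $z_1>\dots>z_n$ sends $m$ to $m\cdot\frac{z_{i_1}}{z_{j_1}}\cdots\frac{z_{i_s}}{z_{j_s}}$, where $i_t<j_t$ for all $t$ and $z_{j_1}\cdots z_{j_s}$ divides $m$. A monomial ideal is strongly stable if it is closed under Borel moves on its monomials. For a set $T$ of monomials of $R$, $Borel(T)$ is the smallest strongly stable ideal of $R$ containing $T$. For a monomial ideal $I\subset S$, $Borel(\psi(I))$ is the smallest strongly stable ideal of $R$ containing $\psi(u)$ for all monomials $u\in I$, and $\overline{I}:=\psi^{-1}(Borel(\psi(I)))$. A monomial ideal $I\subset S$ is $w$-stable if $I=\overline{I}$. *)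

theory Defs
  imports Complex_Main "HOL-Library.Poly_Mapping"
begin

section \<open>Polynomial rings\<close>

text \<open>
  The \<open>n\<close> variables are indexed by a finite linearly ordered type \<open>'n\<close>; a smaller index means
  a larger variable, i.e. \<open>x\<^sub>1 > \<dots> > x\<^sub>n\<close> corresponds to \<open>1 < \<dots> < n\<close>.
  Monomials are exponent vectors, written additively, and a polynomial maps monomials to
  coefficients. Since the source ring \<open>S\<close> and the target ring \<open>R\<close> differ only in the names of
  their variables, both are rendered by the same type.
\<close>

type_synonym ('n, 'k) mpoly = "('n \<Rightarrow>\<^sub>0 nat) \<Rightarrow>\<^sub>0 'k"

definition monomial :: "('n \<Rightarrow>\<^sub>0 nat) \<Rightarrow> ('n, 'k::field) mpoly"
  where "monomial m = Poly_Mapping.single m 1"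

definition const :: "'k \<Rightarrow> ('n, 'k::field) mpoly"
  where "const c = Poly_Mapping.single 0 c"

definition var :: "'n \<Rightarrow> ('n, 'k::field) mpoly"
  where "var i = monomial (Poly_Mapping.single i 1)"

text \<open>Ideals are the submodules of the ring viewed as a module over itself.\<close>

lemma module_times: "module ((*) :: 'a::comm_ring_1 \<Rightarrow> 'a \<Rightarrow> 'a)"
  by unfold_locales (simp_all add: algebra_simps)

definition ideal :: "'a::comm_ring_1 set \<Rightarrow> bool"
  where "ideal = module.subspace (*)"

definition ideal_gen :: "'a::comm_ring_1 set \<Rightarrow> 'a set"
  where "ideal_gen = module.span (*)"

definition monomial_ideal :: "('n, 'k::field) mpoly set \<Rightarrow> bool"
  where "monomial_ideal I \<longleftrightarrow> (\<exists>M. I = ideal_gen (monomial ` M))"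


section \<open>Borel moves and strongly stable ideals\<close>

text \<open>
  The list holds the pairs \<open>(i\<^sub>t, j\<^sub>t)\<close>. The common cofactor \<open>d\<close> expresses both that
  \<open>z\<^bsub>j\<^sub>1\<^esub> \<cdots> z\<^bsub>j\<^sub>s\<^esub>\<close> divides \<open>m\<close> and what the quotient is. The order that the library
  puts on exponent vectors is lexicographic, hence not divisibility.
\<close>

definition borel_move :: "('n::linorder \<Rightarrow>\<^sub>0 nat) \<Rightarrow> ('n \<Rightarrow>\<^sub>0 nat) \<Rightarrow> bool"
  where "borel_move m m' \<longleftrightarrow>
    (\<exists>(ps :: ('n \<times> 'n) list) d.
      (\<forall>(i, j) \<in> set ps. i < j) \<and>
      m = (\<Sum>(i, j)\<leftarrow>ps. Poly_Mapping.single j 1) + d \<and>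
      m' = (\<Sum>(i, j)\<leftarrow>ps. Poly_Mapping.single i 1) + d)"

definition strongly_stable :: "('n::linorder, 'k::field) mpoly set \<Rightarrow> bool"
  where "strongly_stable I \<longleftrightarrow> monomial_ideal I \<and>
    (\<forall>m m'. monomial m \<in> I \<longrightarrow> borel_move m m' \<longrightarrow> monomial m' \<in> I)"

definition Borel :: "('n::linorder, 'k::field) mpoly set \<Rightarrow> ('n, 'k) mpoly set"
  where "Borel T = \<Inter>{J. strongly_stable J \<and> T \<subseteq> J}"


section \<open>Weights\<close>

definition weight_vector :: "('n::linorder \<Rightarrow> nat) \<Rightarrow> bool"
  where "weight_vector w \<longleftrightarrow> (\<forall>i. 0 < w i) \<and> antimono w"

text \<open>
  The substitution \<open>x\<^sub>i \<mapsto> y\<^sub>i\<^sup>w\<^sup>i\<close>; it is characterised as an algebra homomorphism by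
  \<open>psi_hom\<close> and \<open>psi_unique\<close> below.
\<close>

definition psi :: "('n::finite \<Rightarrow> nat) \<Rightarrow> ('n, 'k::field) mpoly \<Rightarrow> ('n, 'k) mpoly"
  where "psi w p =
    (\<Sum>m\<in>Poly_Mapping.keys p.
      const (Poly_Mapping.lookup p m) * (\<Prod>i\<in>UNIV. (var i ^ w i) ^ Poly_Mapping.lookup m i))"

definition w_closure ::
    "('n::{finite,linorder} \<Rightarrow> nat) \<Rightarrow> ('n, 'k::field) mpoly set \<Rightarrow> ('n, 'k) mpoly set"
  where "w_closure w I = psi w -` Borel {psi w (monomial m) | m. monomial m \<in> I}"

definition w_stable ::
    "('n::{finite,linorder} \<Rightarrow> nat) \<Rightarrow> ('n, 'k::field) mpoly set \<Rightarrow> bool"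
  where "w_stable w I \<longleftrightarrow> monomial_ideal I \<and> I = w_closure w I"


section \<open>The smallest strongly stable ideal exists\<close>

lemma monomial_add: "monomial (a + b) = monomial a * monomial b"
  by (simp add: monomial_def mult_single)

lemma const_mult_monomial: "const c * monomial m = Poly_Mapping.single m c"
  by (simp add: monomial_def const_def mult_single)

lemma mpoly_sum_single:
  fixes p :: "('n, 'k::field) mpoly"
  shows "p = (\<Sum>m\<in>Poly_Mapping.keys p. Poly_Mapping.single m (Poly_Mapping.lookup p m))"
proof (rule poly_mapping_eqI)
  fix k
  have "(\<Sum>m\<in>Poly_Mapping.keys p. Poly_Mapping.lookup (Poly_Mapping.single m (Poly_Mapping.lookup p m)) k)
     = (\<Sum>m\<in>Poly_Mapping.keys p. if m = k then Poly_Mapping.lookup p m else 0)"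
    by (intro sum.cong) (auto simp: lookup_single when_def)
  then show "Poly_Mapping.lookup p k =
      Poly_Mapping.lookup (\<Sum>m\<in>Poly_Mapping.keys p. Poly_Mapping.single m (Poly_Mapping.lookup p m)) k"
    by (simp add: lookup_sum in_keys_iff)
qed

lemma monomial_ideal_iff:
  "monomial_ideal I \<longleftrightarrow> ideal I \<and> (\<forall>p\<in>I. \<forall>m\<in>Poly_Mapping.keys p. monomial m \<in> I)"
  for I :: "('n, 'k::field) mpoly set"
proof
  assume "monomial_ideal I"
  then obtain M where I: "I = module.span (*) (monomial ` M)"
    by (auto simp: monomial_ideal_def ideal_gen_def)
  have sub: "module.subspace (*) I"
    unfolding I by (rule module.subspace_span[OF module_times])
  have "\<forall>m\<in>Poly_Mapping.keys p. monomial m \<in> I" if "p \<in> I" for p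
    using that unfolding I
  proof (induction rule: module.span_induct_alt[OF module_times, consumes 1])
    case 1
    then show ?case by simp
  next
    case (2 c x y)
    then obtain a where a: "a \<in> M" "x = monomial a" by auto
    note IH = 2(2)
    show ?case
    proof
      fix m assume "m \<in> Poly_Mapping.keys (c * x + y)"
      then consider "m \<in> Poly_Mapping.keys (c * x)" | "m \<in> Poly_Mapping.keys y"
        using keys_add[of "c * x" y] by blast
      then show "(monomial m :: ('n, 'k) mpoly) \<in> module.span (*) (monomial ` M)"
      proof cases
        case 1
        then obtain k where "m = k + a"
          using keys_mult[of c x] by (auto simp: a monomial_def)
        then show ?thesis
          using a(1) by (simp add: monomial_add module.span_scale[OF module_times]
              module.span_base[OF module_times])
      next
        case 2
        then show ?thesis using IH by simp
      qed
    qed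
  qed
  with sub show "ideal I \<and> (\<forall>p\<in>I. \<forall>m\<in>Poly_Mapping.keys p. monomial m \<in> I)"
    by (auto simp: ideal_def)
next
  assume *: "ideal I \<and> (\<forall>p\<in>I. \<forall>m\<in>Poly_Mapping.keys p. monomial m \<in> I)"
  let ?M = "{m. (monomial m :: ('n, 'k) mpoly) \<in> I}"
  have sub: "module.subspace (*) I" using * by (simp add: ideal_def)
  have "module.span (*) (monomial ` ?M) \<subseteq> I"
    by (rule module.span_minimal[OF module_times _ sub]) auto
  moreover have "p \<in> module.span (*) (monomial ` ?M)" if "p \<in> I" for p
  proof -
    have "(\<Sum>m\<in>Poly_Mapping.keys p. const (Poly_Mapping.lookup p m) * monomial m)
        \<in> module.span (*) (monomial ` ?M)"
      using * that
      by (intro module.span_sum[OF module_times] module.span_scale[OF module_times]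
          module.span_base[OF module_times]) auto
    then show ?thesis
      using mpoly_sum_single[of p] by (simp add: const_mult_monomial)
  qed
  ultimately show "monomial_ideal I"
    by (auto simp: monomial_ideal_def ideal_gen_def intro!: exI[of _ ?M])
qed

lemma strongly_stable_Borel: "strongly_stable (Borel T)"
  unfolding strongly_stable_def monomial_ideal_iff
proof (intro conjI)
  show "ideal (Borel T)"
    unfolding Borel_def ideal_def
    by (rule module.subspace_Inter[OF module_times])
      (auto simp: strongly_stable_def monomial_ideal_iff ideal_def)
qed (auto simp: Borel_def strongly_stable_def monomial_ideal_iff)

lemma subset_Borel: "T \<subseteq> Borel T"
  by (auto simp: Borel_def)

lemma Borel_least: "strongly_stable J \<Longrightarrow> T \<subseteq> J \<Longrightarrow> Borel T \<subseteq> J"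
  by (auto simp: Borel_def)


section \<open>The substitution is the expected algebra homomorphism\<close>

lemma const_mult: "const (a * b) = const a * const b"
  by (simp add: const_def mult_single)

lemma psi_superset:
  assumes "finite A" "Poly_Mapping.keys p \<subseteq> A"
  shows "psi w p = (\<Sum>m\<in>A. const (Poly_Mapping.lookup p m) *
    (\<Prod>i\<in>UNIV. (var i ^ w i) ^ Poly_Mapping.lookup m i))"
  unfolding psi_def using assms
  by (intro sum.mono_neutral_left) (auto simp: in_keys_iff const_def)

lemma psi_single:
  "psi w (Poly_Mapping.single m c) =
    const c * (\<Prod>i\<in>UNIV. (var i ^ w i) ^ Poly_Mapping.lookup m i)"
  using psi_superset[of "{m}" "Poly_Mapping.single m c" w] by simp

lemma psi_add: "psi w (p + q) = psi w p + psi w q"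
proof -
  let ?A = "Poly_Mapping.keys p \<union> Poly_Mapping.keys q"
  have "Poly_Mapping.keys (p + q) \<subseteq> ?A" by (rule keys_add)
  then show ?thesis
    by (simp add: psi_superset[of ?A] lookup_add const_def single_add
        distrib_right sum.distrib)
qed

lemma psi_sum: "psi w (\<Sum>x\<in>A. f x) = (\<Sum>x\<in>A. psi w (f x))"
  by (induction A rule: infinite_finite_induct) (simp_all add: psi_add, simp_all add: psi_def)

lemma psi_mult: "psi w (p * q) = psi w p * psi w q"
proof -
  let ?s = "\<lambda>p m. Poly_Mapping.single m (Poly_Mapping.lookup p m)"
  have single: "psi w (Poly_Mapping.single a c * Poly_Mapping.single b d)
      = psi w (Poly_Mapping.single a c) * psi w (Poly_Mapping.single b d)" for a b c d
    by (simp add: mult_single psi_single const_mult lookup_add power_add prod.distrib)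
  have "psi w (p * q) = psi w ((\<Sum>a\<in>Poly_Mapping.keys p. ?s p a) * (\<Sum>b\<in>Poly_Mapping.keys q. ?s q b))"
    using mpoly_sum_single[of p] mpoly_sum_single[of q] by simp
  also have "\<dots> = psi w (\<Sum>a\<in>Poly_Mapping.keys p. ?s p a) * psi w (\<Sum>b\<in>Poly_Mapping.keys q. ?s q b)"
    by (simp only: sum_product psi_sum single)
  finally show ?thesis
    using mpoly_sum_single[of p] mpoly_sum_single[of q] by simp
qed

lemma psi_const: "psi w (const c) = const c"
  using psi_single[of w 0 c] by (simp add: const_def)

lemma psi_var:
  fixes w :: "'n::finite \<Rightarrow> nat"
  shows "psi w (var i :: ('n, 'k::field) mpoly) = var i ^ w i"
proof -
  have "psi w (var i :: ('n, 'k) mpoly) =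
      const 1 * (\<Prod>j\<in>UNIV. (var j ^ w j) ^ Poly_Mapping.lookup (Poly_Mapping.single i 1) j)"
    unfolding var_def[of i] monomial_def by (rule psi_single)
  also have "\<dots> = (\<Prod>j\<in>UNIV. if j = i then var i ^ w i else 1)"
    unfolding const_def single_one mult_1_left
    by (rule prod.cong) (auto simp: lookup_single when_def)
  finally show ?thesis by simp
qed

lemmas psi_hom = psi_add psi_mult psi_const psi_var

lemma psi_unique:
  fixes h :: "('n::finite, 'k::field) mpoly \<Rightarrow> ('n, 'k) mpoly"
  assumes add: "\<And>p q. h (p + q) = h p + h q"
    and mult: "\<And>p q. h (p * q) = h p * h q"
    and const: "\<And>c. h (const c) = const c"
    and var: "\<And>i. h (var i) = var i ^ w i"
  shows "h = psi w"
proof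
  fix p
  have h0: "h 0 = 0" using const[of 0] by (simp add: const_def)
  have h1: "h 1 = 1" using const[of 1] by (simp add: const_def)
  have hsum: "h (sum f A) = (\<Sum>x\<in>A. h (f x))" for f and A :: "('n \<Rightarrow>\<^sub>0 nat) set"
    by (induction A rule: infinite_finite_induct) (simp_all add: h0 add)
  have hprod: "h (prod f A) = (\<Prod>x\<in>A. h (f x))" for f and A :: "'n set"
    by (induction A rule: infinite_finite_induct) (simp_all add: h1 mult)
  have hpow: "h (q ^ k) = h q ^ k" for q k
    by (induction k) (simp_all add: h1 mult)
  have vpow: "(var i :: ('n, 'k) mpoly) ^ k = monomial (Poly_Mapping.single i k)" for i k
    by (induction k) (simp_all add: monomial_def var_def mult_single flip: single_add)
  have mon: "(monomial m :: ('n, 'k) mpoly) = (\<Prod>i\<in>UNIV. var i ^ Poly_Mapping.lookup m i)" for m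
  proof -
    have "(\<Prod>i\<in>A. (var i :: ('n, 'k) mpoly) ^ Poly_Mapping.lookup m i)
        = monomial (\<Sum>i\<in>A. Poly_Mapping.single i (Poly_Mapping.lookup m i))" if "finite A" for A
      using that by induction (simp_all add: vpow monomial_add, simp add: monomial_def)
    moreover have "(\<Sum>i\<in>UNIV. Poly_Mapping.single i (Poly_Mapping.lookup m i)) = m"
      by (rule poly_mapping_eqI) (simp add: lookup_sum lookup_single when_def)
    ultimately show ?thesis by simp
  qed
  have "h p = h (\<Sum>m\<in>Poly_Mapping.keys p. const (Poly_Mapping.lookup p m) * monomial m)"
    using mpoly_sum_single[of p] by (simp add: const_mult_monomial)
  also have "\<dots> = psi w p"
    by (simp add: hsum mult const mon hprod hpow var psi_def)
  finally show "h p = psi w p" .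
qed

end

theory Submission
  imports Defs
begin

text \<open>
  An elementary move replacing \<open>x\<^sub>j\<close> by \<open>x\<^sub>i\<close> (\<open>i < j\<close>) in a monomial of \<open>S\<close> becomes, after
  applying \<open>\<psi>\<close>, the replacement of \<open>y\<^sub>j\<^sup>w\<^sup>j\<close> by \<open>y\<^sub>i\<^sup>w\<^sup>i\<close>. This is a Borel move turning \<open>y\<^sub>j\<^sup>w\<^sup>j\<close>
  into \<open>y\<^sub>i\<^sup>w\<^sup>j\<close> followed by multiplication with \<open>y\<^sub>i\<close> to the power \<open>w\<^sub>i - w\<^sub>j \<ge> 0\<close>, so it does
  not leave the Borel ideal; hence \<open>w\<close>-stable ideals are closed under elementary moves.
\<close>

lemma monomial_0: "monomial 0 = 1"
  by (simp add: monomial_def)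

lemma var_power: "var i ^ k = monomial (Poly_Mapping.single i k)"
  by (induction k) (simp_all add: monomial_def var_def mult_single flip: single_add)

text \<open>A product of powers of variables is again a monomial. Its exponent vector stays abstract
  as \<open>D\<close>: later steps only compare what one extra variable contributes on top of
  it.\<close>

lemma psi_monomial_cases:
  fixes w :: "'n::finite \<Rightarrow> nat"
  obtains D where "psi w (monomial d :: ('n, 'k::field) mpoly) = monomial D"
proof -
  have prod: "\<exists>D. (\<Prod>i\<in>A. (monomial (f i) :: ('n, 'k) mpoly)) = monomial D"
    for A and f :: "'n \<Rightarrow> 'n \<Rightarrow>\<^sub>0 nat"
  proof (induction A rule: infinite_finite_induct)
    case (insert i A)
    then show ?case
      by (auto simp flip: monomial_add)
  qed (auto intro: exI[of _ 0] simp: monomial_0)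
  have "psi w (monomial d :: ('n, 'k) mpoly) =
      (\<Prod>i\<in>UNIV. monomial (Poly_Mapping.single i (w i * Poly_Mapping.lookup d i)))"
    unfolding monomial_def[of d] psi_single power_mult[symmetric]
    by (simp add: var_power const_def)
  then show thesis
    using prod that by metis
qed

lemma psi_monomial_single_add:
  fixes w :: "'n::finite \<Rightarrow> nat"
  assumes "psi w (monomial d :: ('n, 'k::field) mpoly) = monomial D"
  shows "psi w (monomial (Poly_Mapping.single i 1 + d) :: ('n, 'k) mpoly) =
    monomial (Poly_Mapping.single i (w i) + D)"
  by (simp only: monomial_add psi_mult psi_var var_power assms flip: var_def)

lemma monomial_ideal_add_left:
  "monomial_ideal I \<Longrightarrow> monomial m \<in> I \<Longrightarrow> monomial (k + m) \<in> I"
  using module.subspace_scale[OF module_times]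
  by (auto simp: monomial_ideal_iff ideal_def monomial_add)

text \<open>A single Borel move may repeat a pair, so \<open>k\<close> copies of
  \<open>(i, j)\<close> shift a whole power at once; this is needed for
  \<open>k = w j\<close>.\<close>

lemma borel_move_single:
  assumes "i < j"
  shows "borel_move (Poly_Mapping.single j k + d) (Poly_Mapping.single i k + d)"
proof -
  have *: "(\<Sum>p\<leftarrow>replicate k q. Poly_Mapping.single (f p) 1) = Poly_Mapping.single (f q) k"
    for q :: "'a \<times> 'a" and f :: "'a \<times> 'a \<Rightarrow> 'a"
    by (induction k) (simp_all flip: single_add)
  show ?thesis
    unfolding borel_move_def
    using assms *[of snd "(i, j)"] *[of fst "(i, j)"]
    by (intro exI[of _ "replicate k (i, j)"] exI[of _ d]) (auto simp: case_prod_unfold)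
qed

lemma w_stable_elementary_move:
  fixes w :: "'n::{finite,linorder} \<Rightarrow> nat"
    and I :: "('n, 'k::field) mpoly set"
  assumes w: "weight_vector w" and I: "w_stable w I" and "i < j"
    and m: "monomial (Poly_Mapping.single j 1 + d) \<in> I"
  shows "monomial (Poly_Mapping.single i 1 + d) \<in> I"
proof -
  let ?B = "Borel {psi w (monomial m :: ('n, 'k) mpoly) | m. monomial m \<in> I}"
  obtain D where D: "psi w (monomial d :: ('n, 'k) mpoly) = monomial D"
    by (rule psi_monomial_cases)
  have B: "monomial_ideal ?B" "\<And>m m'. monomial m \<in> ?B \<Longrightarrow> borel_move m m' \<Longrightarrow> monomial m' \<in> ?B"
    using strongly_stable_Borel[of "{psi w (monomial m :: ('n, 'k) mpoly) | m. monomial m \<in> I}"]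
    by (simp_all add: strongly_stable_def)
  have "psi w (monomial (Poly_Mapping.single j 1 + d)) \<in> ?B"
    using m by (intro subsetD[OF subset_Borel]) auto
  then have "monomial (Poly_Mapping.single j (w j) + D) \<in> ?B"
    by (simp only: psi_monomial_single_add[OF D])
  then have "monomial (Poly_Mapping.single i (w j) + D) \<in> ?B"
    by (rule B(2)) (rule borel_move_single[OF \<open>i < j\<close>])
  then have "monomial (Poly_Mapping.single i (w i - w j) + (Poly_Mapping.single i (w j) + D)) \<in> ?B"
    by (rule monomial_ideal_add_left[OF B(1)])
  \<comment> \<open>This makes the truncated difference \<open>w i - w j\<close> exact, so the two
    powers of the variable \<open>i\<close> combine to exponent \<open>w i\<close>.\<close>
  moreover have "w j \<le> w i"
    using w \<open>i < j\<close> by (simp add: weight_vector_def antimonoD less_imp_le)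
  ultimately have "monomial (Poly_Mapping.single i (w i) + D) \<in> ?B"
    by (simp only: le_add_diff_inverse2 flip: add.assoc single_add)
  then have "psi w (monomial (Poly_Mapping.single i 1 + d)) \<in> ?B"
    by (simp only: psi_monomial_single_add[OF D])
  then have "monomial (Poly_Mapping.single i 1 + d) \<in> w_closure w I"
    by (simp add: w_closure_def)
  then show ?thesis
    using I unfolding w_stable_def by blast
qed

theorem proposition2p6:
  fixes w :: "'n::{finite,linorder} \<Rightarrow> nat"
    and I :: "('n, 'k::field) mpoly set"
  assumes "weight_vector w"
    and "monomial_ideal I"
    and "w_stable w I"
  shows "strongly_stable I"
proof -
  have "monomial ((\<Sum>(i, j)\<leftarrow>ps. Poly_Mapping.single i 1) + d) \<in> I"
    if "\<forall>(i, j) \<in> set ps. i < j" "monomial ((\<Sum>(i, j)\<leftarrow>ps. Poly_Mapping.single j 1) + d) \<in> I"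
    for ps :: "('n \<times> 'n) list" and d
    using that
  \<comment> \<open>The pairs of a Borel move are carried out one at a time. The cofactor must vary
    because each newly created variable is absorbed into it.\<close>
  proof (induction ps arbitrary: d)
    case (Cons p ps)
    obtain i j where p: "p = (i, j)" by fastforce
    \<comment> \<open>For the first pair, the variables still to be replaced count as part of the
      cofactor.\<close>
    have "monomial (Poly_Mapping.single i 1 + ((\<Sum>(i, j)\<leftarrow>ps. Poly_Mapping.single j 1) + d)) \<in> I"
      using Cons.prems
      by (intro w_stable_elementary_move[OF assms(1,3), of i j]) (simp_all add: p add.assoc)
    then have "monomial ((\<Sum>(i, j)\<leftarrow>ps. Poly_Mapping.single i 1) + (Poly_Mapping.single i 1 + d)) \<in> I"
      using Cons.prems(1) by (intro Cons.IH) (simp_all add: ac_simps)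
    then show ?case by (simp add: p ac_simps)
  qed simp
  then show ?thesis
    using assms(2) unfolding strongly_stable_def borel_move_def by blast
qed

end
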